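(* For every integer $n\ge 1$, $f_3(2,n) \leq \left\lfloor \frac{n^2}{4}\right\rfloor + 5$.
   Context: A triple system ($3$-uniform hypergraph) is a pair $H=(V,E)$ where $V$ is a nonempty finite set of vertices and $E\subseteq\binom{V}{3}$ (the set of $3$-element subsets of $V$). A set $X\subseteq V$ is a clique of $H$ if $\binom{X}{3}\subseteq E$ (so every set with fewer than $3$ vertices is a clique). A clique is maximal if it is maximal with respect to inclusion, and $c(H)$ is the number of maximal cliques of $H$. The complement of $H$ is $\overline H=(V,\binom{V}{3}\setminus E)$. For $n\ge1$, $f_3(2,n)$ is the minimum of $c(H)+c(\overline H)$ over all triple systems $H$ with $n$ vertices. *)

theory Defs
  imports "HOL-Library.Ramsey"
begin

text \<open>
  A hypergraph is a pair of a vertex set and an edge set. The notation \<open>[V]\<^bsup>3\<^esup>\<close>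
  from Ramsey theory denotes the set of all 3-element subsets of \<open>V\<close>.
\<close>

type_synonym 'a hypergraph = "'a set \<times> 'a set set"

definition triple_system :: "'a hypergraph \<Rightarrow> bool" where
  "triple_system H \<longleftrightarrow> (case H of (V, E) \<Rightarrow> finite V \<and> V \<noteq> {} \<and> E \<subseteq> [V]\<^bsup>3\<^esup>)"

definition hyperclique :: "'a hypergraph \<Rightarrow> 'a set \<Rightarrow> bool" where
  "hyperclique H X \<longleftrightarrow> (case H of (V, E) \<Rightarrow> X \<subseteq> V \<and> [X]\<^bsup>3\<^esup> \<subseteq> E)"

definition maximal_clique :: "'a hypergraph \<Rightarrow> 'a set \<Rightarrow> bool" where
  "maximal_clique H X \<longleftrightarrow> hyperclique H X \<and> (\<forall>Y. hyperclique H Y \<and> X \<subseteq> Y \<longrightarrow> Y = X)"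

definition num_maximal_cliques :: "'a hypergraph \<Rightarrow> nat" where
  "num_maximal_cliques H = card {X. maximal_clique H X}"

definition complement :: "'a hypergraph \<Rightarrow> 'a hypergraph" where
  "complement H = (case H of (V, E) \<Rightarrow> (V, [V]\<^bsup>3\<^esup> - E))"

text \<open>
  The minimum ranges over triple systems whose vertices are natural numbers; this is no
  restriction, see \<open>f3_2_le\<close> below. For \<open>n \<ge> 1\<close> the minimum is attained (\<open>f3_2_attained\<close>);
  the value at \<open>n = 0\<close> has no meaning.
\<close>

definition f3_2 :: "nat \<Rightarrow> nat" where
  "f3_2 n = (LEAST m. \<exists>H :: nat hypergraph. triple_system H \<and> card (fst H) = n \<and>
                m = num_maximal_cliques H + num_maximal_cliques (complement H))"

lemma f3_2_attained:
  assumes "n \<ge> 1"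
  shows "\<exists>H :: nat hypergraph. triple_system H \<and> card (fst H) = n \<and>
           f3_2 n = num_maximal_cliques H + num_maximal_cliques (complement H)"
proof -
  have "triple_system ({..<n}, {}) \<and> card (fst ({..<n}, {} :: nat set set)) = n"
    using assms by (auto simp: triple_system_def lessThan_empty_iff)
  then have "\<exists>m. \<exists>H :: nat hypergraph. triple_system H \<and> card (fst H) = n \<and>
                m = num_maximal_cliques H + num_maximal_cliques (complement H)"
    by blast
  from LeastI_ex[OF this] show ?thesis
    unfolding f3_2_def .
qed

lemma inj_on_image_subset_iff:
  assumes "inj_on g V" "X \<subseteq> V" "Y \<subseteq> V"
  shows "g ` X \<subseteq> g ` Y \<longleftrightarrow> X \<subseteq> Y"
proof
  assume "g ` X \<subseteq> g ` Y"
  then show "X \<subseteq> Y"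
    using inj_on_image_mem_iff[OF assms(1) _ assms(3)] assms(2) by blast
qed blast

lemma nsets_image:
  assumes "inj_on g V" "X \<subseteq> V"
  shows "[g ` X]\<^bsup>k\<^esup> = (`) g ` [X]\<^bsup>k\<^esup>"
proof
  show "(`) g ` [X]\<^bsup>k\<^esup> \<subseteq> [g ` X]\<^bsup>k\<^esup>"
    using assms by (auto simp: nsets_def card_image inj_on_subset)
  show "[g ` X]\<^bsup>k\<^esup> \<subseteq> (`) g ` [X]\<^bsup>k\<^esup>"
  proof
    fix S assume S: "S \<in> [g ` X]\<^bsup>k\<^esup>"
    then obtain T where T: "T \<subseteq> X" "S = g ` T"
      by (auto simp: nsets_def subset_image_iff)
    have "inj_on g T" using T assms by (meson inj_on_subset)
    then show "S \<in> (`) g ` [X]\<^bsup>k\<^esup>"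
      using S T by (auto simp: nsets_def card_image finite_image_iff)
  qed
qed

lemma num_maximal_cliques_image:
  assumes g: "inj_on g V" and E: "E \<subseteq> [V]\<^bsup>3\<^esup>"
  shows "num_maximal_cliques (g ` V, (`) g ` E) = num_maximal_cliques (V, E)"
proof -
  have sub: "g ` X \<subseteq> g ` Y \<longleftrightarrow> X \<subseteq> Y" if "X \<subseteq> V" "Y \<subseteq> V" for X Y
    using inj_on_image_subset_iff[OF g that] .
  have inj: "inj_on ((`) g) (Pow V)"
    using g by (rule inj_on_image_Pow)
  have cl: "hyperclique (g ` V, (`) g ` E) (g ` X) \<longleftrightarrow> hyperclique (V, E) X" if X: "X \<subseteq> V" for X
  proof -
    have P: "[X]\<^bsup>3\<^esup> \<subseteq> Pow V" "E \<subseteq> Pow V"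
      using X E by (auto simp: nsets_def)
    have "g ` X \<subseteq> g ` V"
      using X by (rule image_mono)
    then show ?thesis
      using X inj_on_image_subset_iff[OF inj P]
      by (simp add: hyperclique_def nsets_image[OF g X])
  qed
  have cl_sub: "\<exists>X\<subseteq>V. Y = g ` X" if "hyperclique (g ` V, (`) g ` E) Y" for Y
    using that by (auto simp: hyperclique_def subset_image_iff)
  have mx: "maximal_clique (g ` V, (`) g ` E) (g ` X) \<longleftrightarrow> maximal_clique (V, E) X"
    if X: "X \<subseteq> V" for X
  proof -
    have V: "Y \<subseteq> V" if "hyperclique (V, E) Y" for Y
      using that by (auto simp: hyperclique_def)
    show ?thesis
    proof
      assume L: "maximal_clique (g ` V, (`) g ` E) (g ` X)"
      have "Y = X" if Y: "hyperclique (V, E) Y" "X \<subseteq> Y" for Y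
      proof -
        have "hyperclique (g ` V, (`) g ` E) (g ` Y)" "g ` X \<subseteq> g ` Y"
          using cl[OF V[OF Y(1)]] Y by (blast, blast)
        then have "g ` Y = g ` X"
          using L unfolding maximal_clique_def by blast
        then show ?thesis
          using sub[OF V[OF Y(1)] X] Y(2) by (simp add: subset_antisym)
      qed
      then show "maximal_clique (V, E) X"
        using L cl[OF X] unfolding maximal_clique_def by blast
    next
      assume R: "maximal_clique (V, E) X"
      have *: "Z = g ` X" if Z: "hyperclique (g ` V, (`) g ` E) Z" "g ` X \<subseteq> Z" for Z
      proof -
        obtain Y where Y: "Y \<subseteq> V" "Z = g ` Y"
          using cl_sub[OF Z(1)] by blast
        have "hyperclique (V, E) Y" "X \<subseteq> Y"
          using Z cl[OF Y(1)] sub[OF X Y(1)] by (simp_all add: Y(2))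
        then show ?thesis
          using R Y(2) unfolding maximal_clique_def by blast
      qed
      have "hyperclique (g ` V, (`) g ` E) (g ` X)"
        using R by (simp only: cl[OF X] maximal_clique_def)
      then show "maximal_clique (g ` V, (`) g ` E) (g ` X)"
        unfolding maximal_clique_def by (intro conjI allI impI *) simp_all
    qed
  qed
  have "{Y. maximal_clique (g ` V, (`) g ` E) Y} = (`) g ` {X. maximal_clique (V, E) X}"
  proof (intro set_eqI iffI)
    fix Y assume Y: "Y \<in> {Y. maximal_clique (g ` V, (`) g ` E) Y}"
    then have "hyperclique (g ` V, (`) g ` E) Y"
      unfolding maximal_clique_def by blast
    then obtain X where X: "X \<subseteq> V" "Y = g ` X"
      using cl_sub by blast
    with Y mx[OF X(1)] show "Y \<in> (`) g ` {X. maximal_clique (V, E) X}" by blast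
  next
    fix Y assume "Y \<in> (`) g ` {X. maximal_clique (V, E) X}"
    then obtain X where X: "maximal_clique (V, E) X" "Y = g ` X" by blast
    then have "X \<subseteq> V" by (simp add: maximal_clique_def hyperclique_def)
    with X mx[OF this] show "Y \<in> {Y. maximal_clique (g ` V, (`) g ` E) Y}" by simp
  qed
  moreover have "inj_on ((`) g) {X. maximal_clique (V, E) X}"
    by (rule inj_on_subset[OF inj]) (simp add: maximal_clique_def hyperclique_def subset_iff)
  ultimately show ?thesis
    by (simp add: num_maximal_cliques_def card_image)
qed

lemma f3_2_le:
  fixes H :: "'a hypergraph"
  assumes "triple_system H" "card (fst H) = n"
  shows "f3_2 n \<le> num_maximal_cliques H + num_maximal_cliques (complement H)"
proof -
  obtain V E where H: "H = (V, E)" by (cases H)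
  have fin: "finite V" "V \<noteq> {}" and E: "E \<subseteq> [V]\<^bsup>3\<^esup>"
    using assms by (auto simp: H triple_system_def)
  obtain g :: "'a \<Rightarrow> nat" where g: "inj_on g V"
    using finite_imp_inj_to_nat_seg[OF fin(1)] by auto
  let ?H = "(g ` V, (`) g ` E)"
  have E': "[V]\<^bsup>3\<^esup> - E \<subseteq> [V]\<^bsup>3\<^esup>" by blast
  have "inj_on ((`) g) ([V]\<^bsup>3\<^esup>)"
    by (rule inj_on_subset[OF inj_on_image_Pow[OF g]]) (auto simp: nsets_def)
  then have "(`) g ` ([V]\<^bsup>3\<^esup> - E) = (`) g ` [V]\<^bsup>3\<^esup> - (`) g ` E"
    using E by (metis inj_on_image_set_diff order_refl Diff_subset)
  then have co: "complement ?H = (g ` V, (`) g ` ([V]\<^bsup>3\<^esup> - E))"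
    by (simp add: complement_def nsets_image[OF g order_refl])
  have "(`) g ` E \<subseteq> [g ` V]\<^bsup>3\<^esup>"
    using E by (simp add: nsets_image[OF g order_refl] image_mono)
  then have "triple_system ?H \<and> card (fst ?H) = n"
    using fin assms(2) g by (simp add: triple_system_def card_image H)
  then have "f3_2 n \<le> num_maximal_cliques ?H + num_maximal_cliques (complement ?H)"
    unfolding f3_2_def by (intro Least_le) blast
  also have "\<dots> = num_maximal_cliques H + num_maximal_cliques (complement H)"
    unfolding co num_maximal_cliques_image[OF g E] num_maximal_cliques_image[OF g E']
    by (simp add: H complement_def)
  finally show ?thesis .
qed

end

theory Submission
  imports Defs
begin

text \<open>
  A triple system and its complement are a colouring of all triples with two colours, red and
  blue, and the bound is witnessed by an explicit colouring. Its starting point is the split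
  \<open>V = A \<union> B\<close> into halves in which a triple is red iff at least two of its vertices lie in \<open>A\<close>.
  The maximal red cliques are the pairs inside \<open>B\<close> and the sets \<open>A \<union> {y}\<close> with \<open>y \<in> B\<close>; the
  maximal blue cliques are the pairs inside \<open>A\<close> and the sets \<open>{x} \<union> B\<close> with \<open>x \<in> A\<close>.
  That is \<open>C(a,2) + C(b,2) + a + b\<close> for \<open>|A| = a\<close>, \<open>|B| = b\<close>, about
  \<open>n\<^sup>2/4 + n/2\<close>, so a linear term has to be removed.

  Each pair inside \<open>A\<close> or inside \<open>B\<close> is a maximal clique of its own, so it pays to move vertices
  out of the two halves. Moving four of them into a set \<open>hubs\<close> lowers the quadratic part by
  \<open>2n - O(1)\<close>, and leaves room for about \<open>5n/2\<close> further cliques, that is, for five families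
  indexed by \<open>A\<close> or by \<open>B\<close>. The colouring of the triples that meet \<open>hubs\<close> has to keep to this
  budget. It is governed by the three perfect matchings \<open>M1\<close>, \<open>M2\<close>, \<open>M3\<close> of the four hubs:
  together with two hubs, a vertex of \<open>A\<close> forms a blue triple on \<open>M1\<close> and a red one on \<open>M2\<close> and
  \<open>M3\<close>, whereas a vertex of \<open>B\<close> forms a blue triple on \<open>M1\<close> and \<open>M2\<close> and a red one on \<open>M3\<close>.
  One hub with two vertices of \<open>A\<close>, or with one vertex of each half, gives a red triple; one hub
  with two vertices of \<open>B\<close>, and three hubs, give a blue one.

  The point of using matchings is that any two of them form a 4-cycle, whose complement is
  the third one. The hubs of a blue clique that meets \<open>A\<close> therefore lie in one edge of \<open>M1\<close> (unless
  it meets \<open>B\<close> too, when it has no hub at all), and the hubs of a blue clique that meets \<open>B\<close>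
  lie in one edge of \<open>M1\<close> or \<open>M2\<close>; similarly for red. Every red clique is contained in a
  member of \<open>red_cover\<close> and every blue one in a member of \<open>blue_cover\<close> (lemmas
  \<open>red_clique_covered\<close> and \<open>blue_clique_covered\<close>). These consist of cliques, and their sizes add
  up to at most \<open>C(a,2) + C(b,2) + 3a + 2b + 9\<close>, which for \<open>n = a + b + 4\<close> with \<open>b = a\<close> or
  \<open>b = a + 1\<close> equals \<open>\<lfloor>n\<^sup>2/4\<rfloor> + 5\<close>. The argument needs \<open>b \<ge> 1\<close>; for \<open>n \<le> 4\<close> the triple system
  without edges is good enough.
\<close>

section \<open>Bounding the number of maximal cliques\<close>

text \<open>
  A maximal clique contained in a clique of \<open>F\<close> is equal to it, so \<open>F\<close> contains all maximal cliques.
\<close>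

lemma num_maximal_cliques_le_card_cover:
  assumes "finite F"
    and F: "\<And>X. X \<in> F \<Longrightarrow> hyperclique H X"
    and cover: "\<And>X. hyperclique H X \<Longrightarrow> \<exists>Y\<in>F. X \<subseteq> Y"
  shows "num_maximal_cliques H \<le> card F"
proof -
  have "{X. maximal_clique H X} \<subseteq> F"
  proof
    fix X assume "X \<in> {X. maximal_clique H X}"
    then have X: "hyperclique H X" "\<And>Y. hyperclique H Y \<Longrightarrow> X \<subseteq> Y \<Longrightarrow> Y = X"
      by (simp_all add: maximal_clique_def)
    obtain Y where Y: "Y \<in> F" "X \<subseteq> Y" using cover[OF X(1)] by blast
    with X(2)[OF F[OF Y(1)]] show "X \<in> F" by simp
  qed
  then show ?thesis
    unfolding num_maximal_cliques_def using assms(1) by (simp add: card_mono)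
qed

section \<open>The colouring\<close>

text \<open>
  The vertices of \<open>A\<close> are \<open>Red i\<close> and those of \<open>B\<close> are \<open>Blue j\<close>, after the colour of the triples
  inside each half.
\<close>

datatype vertex = Red nat | Blue nat | P | Q | R | S

definition hubs :: "vertex set" where "hubs = {P, Q, R, S}"

text \<open>The three perfect matchings of the hubs.\<close>

definition M1 :: "vertex set set" where "M1 = {{P, Q}, {R, S}}"
definition M2 :: "vertex set set" where "M2 = {{P, R}, {Q, S}}"
definition M3 :: "vertex set set" where "M3 = {{P, S}, {Q, R}}"

lemma M2_E:
  assumes "e \<in> M2" obtains s t where "e = {s, t}"
proof -
  have "e = {P, R} \<or> e = {Q, S}" using assms by (simp add: M2_def)
  then show ?thesis using that by (elim disjE)
qed

lemma M3_E:
  assumes "e \<in> M3" obtains s t where "e = {s, t}" "s \<noteq> t" "s \<in> hubs" "t \<in> hubs"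
proof -
  have "e = {P, S} \<or> e = {Q, R}" using assms by (simp add: M3_def)
  then show ?thesis using that[of P S] that[of Q R] by (auto simp: hubs_def)
qed

definition verts :: "nat \<Rightarrow> nat \<Rightarrow> vertex set" where
  "verts a b = Red ` {..<a} \<union> Blue ` {..<b} \<union> hubs"

text \<open>
  This describes the red triples by the configurations that they contain, and so makes sense
  for sets of any size. As a predicate of all sets it is monotone, and a set of
  vertices that is not \<open>red\<close> is a blue clique.
\<close>

definition red :: "vertex set \<Rightarrow> bool" where
  "red T \<longleftrightarrow>
     (\<exists>i j. i \<noteq> j \<and> Red i \<in> T \<and> Red j \<in> T) \<or>
     (\<exists>i j. \<exists>s\<in>hubs. Red i \<in> T \<and> Blue j \<in> T \<and> s \<in> T) \<or>
     (\<exists>i. \<exists>e\<in>M2 \<union> M3. Red i \<in> T \<and> e \<subseteq> T) \<or>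
     (\<exists>j. \<exists>e\<in>M3. Blue j \<in> T \<and> e \<subseteq> T)"

lemma redI:
  "Red i \<in> T \<Longrightarrow> Red j \<in> T \<Longrightarrow> i \<noteq> j \<Longrightarrow> red T"
  "Red i \<in> T \<Longrightarrow> Blue j \<in> T \<Longrightarrow> s \<in> T \<Longrightarrow> s \<in> hubs \<Longrightarrow> red T"
  "Red i \<in> T \<Longrightarrow> e \<in> M2 \<union> M3 \<Longrightarrow> e \<subseteq> T \<Longrightarrow> red T"
  "Blue j \<in> T \<Longrightarrow> e \<in> M3 \<Longrightarrow> e \<subseteq> T \<Longrightarrow> red T"
  subgoal unfolding red_def by (rule disjI1) blast
  subgoal unfolding red_def by (rule disjI2, rule disjI1) blast
  subgoal unfolding red_def by (rule disjI2, rule disjI2, rule disjI1) blast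
  subgoal unfolding red_def by (rule disjI2, rule disjI2, rule disjI2) blast
  done

lemma red_mono:
  assumes "red T" "T \<subseteq> X"
  shows "red X"
  using assms(1) unfolding red_def[of T]
proof (elim disjE exE bexE conjE)
  fix i j assume "i \<noteq> j" "Red i \<in> T" "Red j \<in> T"
  then show ?thesis using assms(2) by (intro redI(1)[of i _ j]) auto
next
  fix i j s assume "s \<in> hubs" "Red i \<in> T" "Blue j \<in> T" "s \<in> T"
  then show ?thesis using assms(2) by (intro redI(2)[of i _ j s]) auto
next
  fix i e assume "e \<in> M2 \<union> M3" "Red i \<in> T" "e \<subseteq> T"
  then show ?thesis using assms(2) by (intro redI(3)[of i _ e]) auto
next
  fix j e assume "e \<in> M3" "Blue j \<in> T" "e \<subseteq> T"
  then show ?thesis using assms(2) by (intro redI(4)[of j _ e]) auto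
qed

definition hub_system :: "nat \<Rightarrow> nat \<Rightarrow> vertex hypergraph" where
  "hub_system a b = (verts a b, {T \<in> [verts a b]\<^bsup>3\<^esup>. red T})"

section \<open>The covering families and their sizes\<close>

definition red_cover :: "nat \<Rightarrow> nat \<Rightarrow> vertex set set" where
  "red_cover a b =
     [Blue ` {..<b}]\<^bsup>2\<^esup> \<union>
     (\<lambda>(j, e). Red ` {..<a} \<union> {Blue j} \<union> e) ` ({..<b} \<times> M3) \<union>
     (\<lambda>e. Red ` {..<a} \<union> e) ` M2 \<union>
     M1"

definition blue_cover :: "nat \<Rightarrow> nat \<Rightarrow> vertex set set" where
  "blue_cover a b =
     [Red ` {..<a}]\<^bsup>2\<^esup> \<union>
     (\<lambda>i. {Red i} \<union> Blue ` {..<b}) ` {..<a} \<union>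
     (\<lambda>(i, e). {Red i} \<union> e) ` ({..<a} \<times> M1) \<union>
     (\<lambda>e. Blue ` {..<b} \<union> e) ` (M1 \<union> M2) \<union>
     {hubs}"

lemma finite_M: "finite M1" "finite M2" "finite M3"
  by (simp_all add: M1_def M2_def M3_def)

lemma card_M: "card M1 \<le> 2" "card M2 \<le> 2" "card M3 \<le> 2"
  by (simp_all add: M1_def M2_def M3_def card_insert_if)

lemma card_red_cover: "finite (red_cover a b)" "card (red_cover a b) \<le> (b choose 2) + 2 * b + 4"
proof -
  let ?F1 = "[Blue ` {..<b}]\<^bsup>2\<^esup>"
  let ?F2 = "(\<lambda>(j, e). Red ` {..<a} \<union> {Blue j} \<union> e) ` ({..<b} \<times> M3)"
  let ?F3 = "(\<lambda>e. Red ` {..<a} \<union> e) ` M2"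
  show "finite (red_cover a b)"
    by (simp add: red_cover_def finite_M finite_imp_finite_nsets)
  have "card ?F1 = b choose 2"
    by (simp add: card_image inj_on_def)
  moreover have "card ?F2 \<le> card ({..<b} \<times> M3)" "card ?F3 \<le> card M2"
    by (simp_all only: card_image_le finite_cartesian_product finite_lessThan finite_M)
  moreover have "card ({..<b} \<times> M3) \<le> b * 2"
    by (simp add: card_cartesian_product card_M)
  moreover have "card (red_cover a b) \<le> card ?F1 + card ?F2 + card ?F3 + card M1"
    unfolding red_cover_def by (meson add_mono card_Un_le le_refl order_trans)
  ultimately show "card (red_cover a b) \<le> (b choose 2) + 2 * b + 4"
    using card_M by linarith
qed

lemma card_blue_cover: "finite (blue_cover a b)" "card (blue_cover a b) \<le> (a choose 2) + 3 * a + 5"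
proof -
  let ?F1 = "[Red ` {..<a}]\<^bsup>2\<^esup>"
  let ?F2 = "(\<lambda>i. {Red i} \<union> Blue ` {..<b}) ` {..<a}"
  let ?F3 = "(\<lambda>(i, e). {Red i} \<union> e) ` ({..<a} \<times> M1)"
  let ?F4 = "(\<lambda>e. Blue ` {..<b} \<union> e) ` (M1 \<union> M2)"
  show "finite (blue_cover a b)"
    by (simp add: blue_cover_def finite_M finite_imp_finite_nsets)
  have "card ?F1 = a choose 2"
    by (simp add: card_image inj_on_def)
  moreover have "card ?F2 \<le> card {..<a}" "card ?F3 \<le> card ({..<a} \<times> M1)"
      "card ?F4 \<le> card (M1 \<union> M2)"
    by (simp_all only: card_image_le finite_cartesian_product finite_lessThan finite_M finite_Un)
  moreover have "card ({..<a} \<times> M1) \<le> a * 2" "card (M1 \<union> M2) \<le> card M1 + card M2"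
    by (simp_all add: card_cartesian_product card_M card_Un_le)
  moreover have "card (blue_cover a b) \<le> card ?F1 + card ?F2 + card ?F3 + card ?F4 + card {hubs}"
    unfolding blue_cover_def by (meson add_mono card_Un_le le_refl order_trans)
  ultimately show "card (blue_cover a b) \<le> (a choose 2) + 3 * a + 5"
    using card_M by simp
qed

section \<open>The members of the covering families are cliques\<close>

lemma hyperclique_hub_systemI:
  assumes "X \<subseteq> verts a b" and "\<And>T. T \<subseteq> X \<Longrightarrow> card T = 3 \<Longrightarrow> red T"
  shows "hyperclique (hub_system a b) X"
  using assms unfolding hyperclique_def hub_system_def nsets_def by auto

lemma hyperclique_complementI:
  assumes "X \<subseteq> verts a b" and "\<And>T. T \<subseteq> X \<Longrightarrow> card T = 3 \<Longrightarrow> \<not> red T"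
  shows "hyperclique (complement (hub_system a b)) X"
  using assms unfolding hyperclique_def hub_system_def complement_def nsets_def by auto

lemma no_triple_in_pair: "card X = 2 \<Longrightarrow> T \<subseteq> X \<Longrightarrow> card T \<noteq> 3"
  using card_mono[of X T] by (cases "finite X") auto

lemma triple_misses_at_most_one:
  assumes "finite U" "card U \<le> 4" "T \<subseteq> U" "card T = 3"
  obtains u where "U - {u} \<subseteq> T"
proof -
  have "card (U - T) \<le> Suc 0"
    using assms by (subst card_Diff_subset) (auto intro: finite_subset)
  then have "\<exists>u. U - T \<subseteq> {u}"
    using assms(1) by (simp add: card_le_Suc0_iff_eq) blast
  then show ?thesis using that by blast
qed

text \<open>
  Two vertices of \<open>A\<close> make a triple red at once, so only triples with at most one vertex
  of \<open>A\<close> matter, and these lie inside sets of at most four elements.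
\<close>

lemma red_cover_cliques:
  assumes "X \<in> red_cover a b"
  shows "hyperclique (hub_system a b) X"
proof (rule hyperclique_hub_systemI)
  show "X \<subseteq> verts a b"
    using assms by (auto simp: red_cover_def verts_def hubs_def M1_def M2_def M3_def nsets_def)
next
  fix T
  assume T: "T \<subseteq> X" "card T = 3"
  show "red T"
  proof (cases "\<exists>i k. i \<noteq> k \<and> Red i \<in> T \<and> Red k \<in> T")
    case True then show ?thesis using redI(1) by blast
  next
    case False
    then obtain i where i: "\<And>k. Red k \<in> T \<Longrightarrow> k = i" by metis
    consider "card X = 2" | j e where "e \<in> M3" "X = Red ` {..<a} \<union> {Blue j} \<union> e"
      | e where "e \<in> M2" "X = Red ` {..<a} \<union> e"
      using assms by (auto simp: red_cover_def nsets_def M1_def)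
    then show ?thesis
    proof cases
      case 1 with T show ?thesis using no_triple_in_pair by blast
    next
      case (2 j e)
      obtain s t where e: "e = {s, t}" "s \<noteq> t" "s \<in> hubs" "t \<in> hubs"
        using 2(1) by (rule M3_E)
      let ?U = "{Red i, Blue j, s, t}"
      have "T \<subseteq> ?U" using T(1) i unfolding 2(2) e(1) by auto
      then obtain u where u: "?U - {u} \<subseteq> T"
        using T(2) by (rule_tac triple_misses_at_most_one) (auto simp: card_insert_if)
      show ?thesis
      proof (cases "e \<subseteq> T")
        case True
        have "Red i \<in> T \<or> Blue j \<in> T" using u by (cases "u = Red i") auto
        then show ?thesis using redI(3,4) True 2(1) by blast
      next
        case False
        then have "u \<in> e" using u e(1) by auto
        then have "Red i \<in> T" "Blue j \<in> T" using u e by (auto simp: hubs_def)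
        moreover have "s \<in> T \<or> t \<in> T"
          using u e(2) by (cases "u = s") auto
        ultimately show ?thesis using redI(2) e(3,4) by blast
      qed
    next
      case (3 e)
      obtain s t where e: "e = {s, t}"
        using 3(1) by (rule M2_E)
      have "T \<subseteq> {Red i, s, t}" using T(1) i unfolding 3(2) e by auto
      then have "T = {Red i, s, t}"
        using T(2) by (intro card_seteq) (simp_all add: card_insert_if)
      then show ?thesis using redI(3)[of i T e] 3(1) e by blast
    qed
  qed
qed

text \<open>
  Apart from the pairs, no member of the family is \<open>red\<close> as a whole, and \<open>red\<close> is monotone.
\<close>

lemma blue_cover_cliques:
  assumes "X \<in> blue_cover a b"
  shows "hyperclique (complement (hub_system a b)) X"
proof (rule hyperclique_complementI)
  show "X \<subseteq> verts a b"
    using assms by (auto simp: blue_cover_def verts_def hubs_def M1_def M2_def M3_def nsets_def)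
next
  fix T
  assume T: "T \<subseteq> X" "card T = 3"
  consider "card X = 2" | "\<not> red X"
    using assms unfolding blue_cover_def
  proof (elim UnE)
    assume "X \<in> [Red ` {..<a}]\<^bsup>2\<^esup>"
    then show thesis using that(1) by (simp add: nsets_def)
  next
    assume "X \<in> (\<lambda>i. {Red i} \<union> Blue ` {..<b}) ` {..<a}"
    then have "\<not> red X" by (auto simp: red_def hubs_def M2_def M3_def)
    then show thesis by (rule that(2))
  next
    assume "X \<in> (\<lambda>(i, e). {Red i} \<union> e) ` ({..<a} \<times> M1)"
    then have "\<not> red X" by (auto simp: red_def hubs_def M1_def M2_def M3_def)
    then show thesis by (rule that(2))
  next
    assume "X \<in> (\<lambda>e. Blue ` {..<b} \<union> e) ` (M1 \<union> M2)"
    then have "\<not> red X" by (auto simp: red_def hubs_def M1_def M2_def M3_def)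
    then show thesis by (rule that(2))
  next
    assume "X \<in> {hubs}"
    then have "\<not> red X" by (auto simp: red_def hubs_def)
    then show thesis by (rule that(2))
  qed
  then show "\<not> red T"
  proof cases
    case 1 with T show ?thesis using no_triple_in_pair by blast
  next
    case 2 with T show ?thesis using red_mono by blast
  qed
qed

section \<open>The covering families cover all cliques\<close>

lemma triple_in_clique:
  assumes "hyperclique (hub_system a b) X" "x \<in> X" "y \<in> X" "z \<in> X" "x \<noteq> y" "x \<noteq> z" "y \<noteq> z"
  shows "red {x, y, z}"
proof -
  have "{x, y, z} \<in> [X]\<^bsup>3\<^esup>" using assms by (simp add: nsets_def)
  then show ?thesis using assms(1) by (auto simp: hyperclique_def hub_system_def)
qed

lemma triple_in_coclique:
  assumes "hyperclique (complement (hub_system a b)) X"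
    "x \<in> X" "y \<in> X" "z \<in> X" "x \<noteq> y" "x \<noteq> z" "y \<noteq> z"
  shows "\<not> red {x, y, z}"
proof -
  have "{x, y, z} \<in> [X]\<^bsup>3\<^esup>" using assms by (simp add: nsets_def)
  then show ?thesis using assms(1) by (auto simp: hyperclique_def hub_system_def complement_def)
qed

text \<open>
  The next three lemmas are facts on the subsets of a 4-element set. In the first, sets with at
  most one hub fall under the third alternative.
\<close>

lemma hub_trace_cases:
  "(\<exists>e\<in>M1. e \<subseteq> X) \<or> (\<exists>e\<in>M2. e \<subseteq> X \<and> X \<inter> hubs \<subseteq> e) \<or> (\<exists>e\<in>M3. X \<inter> hubs \<subseteq> e)"
  by (auto simp: M1_def M2_def M3_def hubs_def Int_insert_right)

lemma hub_trace_avoiding_M3: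
  assumes "\<forall>e\<in>M3. \<not> e \<subseteq> X"
  shows "\<exists>e\<in>M1 \<union> M2. X \<inter> hubs \<subseteq> e"
  using assms by (auto simp: M1_def M2_def M3_def hubs_def Int_insert_right)

lemma hub_trace_avoiding_M2_M3:
  assumes "\<forall>e\<in>M2 \<union> M3. \<not> e \<subseteq> X"
  shows "\<exists>e\<in>M1. X \<inter> hubs \<subseteq> e"
  using assms by (auto simp: M1_def M2_def M3_def hubs_def Int_insert_right)

text \<open>
  Two vertices of \<open>B\<close> form no red triple at all, so a red clique that is not a pair has at most one
  of them. What else it contains is decided by its hubs: an edge of \<open>M1\<close> admits no further
  vertex, an edge of \<open>M2\<close> only those of \<open>A\<close>, and an edge of \<open>M3\<close> also the one of \<open>B\<close>.
\<close>

lemma red_clique_covered: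
  assumes X: "hyperclique (hub_system a b) X" and b: "b \<ge> 1"
  shows "\<exists>Y\<in>red_cover a b. X \<subseteq> Y"
proof -
  note T = triple_in_clique[OF X]
  have sub: "X \<subseteq> verts a b" using X by (simp add: hyperclique_def hub_system_def)
  show ?thesis
  proof (cases "\<exists>i j. i \<noteq> j \<and> Blue i \<in> X \<and> Blue j \<in> X")
    case True
    then obtain i j where ij: "i \<noteq> j" "Blue i \<in> X" "Blue j \<in> X" by blast
    have "x \<in> {Blue i, Blue j}" if "x \<in> X" for x
      using T[OF ij(2,3) that] ij(1) by (auto simp: red_def hubs_def M2_def M3_def)
    moreover have "{Blue i, Blue j} \<in> [Blue ` {..<b}]\<^bsup>2\<^esup>"
      using ij sub by (auto simp: nsets_def verts_def hubs_def)
    ultimately show ?thesis unfolding red_cover_def by blast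
  next
    case False
    \<comment> \<open>If \<open>X\<close> does not meet \<open>B\<close>, then any vertex of \<open>B\<close> may be added; this is where \<open>b \<ge> 1\<close> enters.\<close>
    then obtain j where j: "j < b" "\<And>i. Blue i \<in> X \<Longrightarrow> i = j"
    proof (cases "\<exists>i. Blue i \<in> X")
      case True
      then obtain i where "Blue i \<in> X" by blast
      moreover from this have "i < b" using sub by (auto simp: verts_def hubs_def)
      ultimately show ?thesis using that False by blast
    next
      case False
      then show ?thesis using that[of 0] b by auto
    qed
    have M1: "X \<subseteq> e" if "e \<in> M1" "e \<subseteq> X" for e
    proof
      fix x assume "x \<in> X"
      with that T[of P Q x] T[of R S x] show "x \<in> e"
        by (auto simp: M1_def red_def hubs_def M2_def M3_def)
    qed
    have M2: "Blue j \<notin> X" if "e \<in> M2" "e \<subseteq> X" for e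
      using that T[of P R "Blue j"] T[of Q S "Blue j"]
      by (auto simp: M2_def red_def hubs_def M3_def)
    have X': "X \<subseteq> Red ` {..<a} \<union> {Blue j} \<union> (X \<inter> hubs)"
      using sub j(2) by (auto simp: verts_def)
    consider (1) e where "e \<in> M1" "e \<subseteq> X" | (2) e where "e \<in> M2" "e \<subseteq> X" "X \<inter> hubs \<subseteq> e"
      | (3) e where "e \<in> M3" "X \<inter> hubs \<subseteq> e"
      using hub_trace_cases by blast
    then show ?thesis
    proof cases
      case 1 then show ?thesis using M1 unfolding red_cover_def by blast
    next
      case 2 then have "X \<subseteq> Red ` {..<a} \<union> e" using M2[OF 2(1,2)] X' by blast
      then show ?thesis using 2 unfolding red_cover_def by blast
    next
      case 3 then have "X \<subseteq> Red ` {..<a} \<union> {Blue j} \<union> e" using X' by auto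
      moreover have "Red ` {..<a} \<union> {Blue j} \<union> e \<in> red_cover a b"
        unfolding red_cover_def
        by (rule UnI1, rule UnI1, rule UnI2, rule rev_image_eqI[of "(j, e)"]) (simp_all add: 3 j(1))
      ultimately show ?thesis by blast
    qed
  qed
qed

text \<open>
  Two vertices of \<open>A\<close> form no blue triple, so a blue clique that is not a pair has at most one of them.
  If it has one, then it cannot meet both \<open>B\<close> and the hubs, and its hubs avoid \<open>M2\<close> and \<open>M3\<close>;
  otherwise its hubs need only avoid \<open>M3\<close>, and only if it meets \<open>B\<close>.
\<close>

lemma blue_clique_covered:
  assumes X: "hyperclique (complement (hub_system a b)) X"
  shows "\<exists>Y\<in>blue_cover a b. X \<subseteq> Y"
proof -
  note T = triple_in_coclique[OF X]
  have sub: "X \<subseteq> verts a b" using X by (simp add: hyperclique_def hub_system_def complement_def)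
  consider (2) i j where "i \<noteq> j" "Red i \<in> X" "Red j \<in> X"
    | (1) i where "Red i \<in> X" "\<And>j. Red j \<in> X \<Longrightarrow> j = i" | (0) "\<And>i. Red i \<notin> X"
    by blast
  then show ?thesis
  proof cases
    case 2
    have "x \<in> {Red i, Red j}" if "x \<in> X" for x
      using T[OF 2(2,3) that] 2(1) redI(1)[of i "{Red i, Red j, x}" j] by auto
    moreover have "{Red i, Red j} \<in> [Red ` {..<a}]\<^bsup>2\<^esup>"
      using 2 sub by (auto simp: nsets_def verts_def hubs_def)
    ultimately show ?thesis unfolding blue_cover_def by blast
  next
    case 1
    have i: "i < a" using 1(1) sub by (auto simp: verts_def hubs_def)
    show ?thesis
    proof (cases "\<exists>j. Blue j \<in> X")
      case True
      then obtain j where j: "Blue j \<in> X" by blast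
      have "x \<notin> hubs" if "x \<in> X" for x
        using T[OF 1(1) j that] by (auto simp: red_def hubs_def)
      then have "X \<subseteq> {Red i} \<union> Blue ` {..<b}" using sub 1(2) by (auto simp: verts_def)
      then show ?thesis using i unfolding blue_cover_def by blast
    next
      case False
      have "\<forall>e\<in>M2 \<union> M3. \<not> e \<subseteq> X"
        using T[OF 1(1), of P R] T[OF 1(1), of Q S] T[OF 1(1), of P S] T[OF 1(1), of Q R]
        by (auto simp: red_def M2_def M3_def)
      then obtain e where e: "e \<in> M1" "X \<inter> hubs \<subseteq> e"
        using hub_trace_avoiding_M2_M3 by blast
      then have "X \<subseteq> {Red i} \<union> e"
        using sub False 1(2) by (auto simp: verts_def)
      moreover have "{Red i} \<union> e \<in> blue_cover a b"
        unfolding blue_cover_def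
        by (rule UnI1, rule UnI1, rule UnI2, rule rev_image_eqI[of "(i, e)"]) (simp_all add: i e(1))
      ultimately show ?thesis by blast
    qed
  next
    case 0
    show ?thesis
    proof (cases "\<exists>j. Blue j \<in> X")
      case True
      then obtain j where j: "Blue j \<in> X" by blast
      have "\<forall>e\<in>M3. \<not> e \<subseteq> X"
        using T[OF j, of P S] T[OF j, of Q R] by (auto simp: red_def M3_def)
      then obtain e where e: "e \<in> M1 \<union> M2" "X \<inter> hubs \<subseteq> e"
        using hub_trace_avoiding_M3 by blast
      then have "X \<subseteq> Blue ` {..<b} \<union> e"
        using sub 0 by (auto simp: verts_def)
      moreover have "Blue ` {..<b} \<union> e \<in> blue_cover a b"
        unfolding blue_cover_def by (rule UnI1, rule UnI2, rule imageI) (rule e(1))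
      ultimately show ?thesis by blast
    next
      case False
      then have "X \<subseteq> hubs" using sub 0 by (auto simp: verts_def)
      then show ?thesis unfolding blue_cover_def by blast
    qed
  qed
qed

section \<open>The upper bound\<close>

lemma f3_2_le_hub_system:
  assumes "b \<ge> 1"
  shows "f3_2 (a + b + 4) \<le> (a choose 2) + (b choose 2) + 3 * a + 2 * b + 9"
proof -
  have "card (Red ` {..<a} \<union> Blue ` {..<b} \<union> hubs) = card (Red ` {..<a} \<union> Blue ` {..<b}) + card hubs"
    by (rule card_Un_disjoint) (auto simp: hubs_def)
  also have "card (Red ` {..<a} \<union> Blue ` {..<b}) = card (Red ` {..<a}) + card (Blue ` {..<b})"
    by (rule card_Un_disjoint) auto
  finally have "card (fst (hub_system a b)) = a + b + 4"
    by (simp add: hub_system_def verts_def card_image inj_on_def) (simp add: hubs_def)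
  moreover have "triple_system (hub_system a b)"
    by (auto simp: triple_system_def hub_system_def verts_def hubs_def)
  moreover have "num_maximal_cliques (hub_system a b) \<le> card (red_cover a b)"
    using card_red_cover(1) red_cover_cliques red_clique_covered[OF _ assms]
    by (rule num_maximal_cliques_le_card_cover)
  moreover have "num_maximal_cliques (complement (hub_system a b)) \<le> card (blue_cover a b)"
    using card_blue_cover(1) blue_cover_cliques blue_clique_covered
    by (rule num_maximal_cliques_le_card_cover)
  ultimately show ?thesis
    using f3_2_le[of "hub_system a b" "a + b + 4"] card_red_cover(2)[of a b] card_blue_cover(2)[of a b]
    by linarith
qed

text \<open>
  Without edges the cliques are the sets with at most two vertices, so the maximal ones are the
  pairs; the minimum with 2 accounts for a single vertex.
\<close>

lemma f3_2_le_empty_system: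
  assumes "n \<ge> 1"
  shows "f3_2 n \<le> (n choose min 2 n) + 1"
proof -
  let ?V = "{..<n}" let ?H = "({..<n}, {}) :: nat hypergraph"
  have "num_maximal_cliques ?H \<le> card ([?V]\<^bsup>min 2 n\<^esup>)"
  proof (rule num_maximal_cliques_le_card_cover)
    show "finite ([?V]\<^bsup>min 2 n\<^esup>)" by (simp add: finite_imp_finite_nsets)
    show "hyperclique ?H X" if "X \<in> [?V]\<^bsup>min 2 n\<^esup>" for X
    proof -
      have "finite X" "card X < 3" using that by (auto simp: nsets_def)
      then have "[X]\<^bsup>3\<^esup> = {}" by (simp add: nsets_eq_empty_iff)
      then show ?thesis using that by (simp add: hyperclique_def nsets_def)
    qed
    show "\<exists>Y\<in>[?V]\<^bsup>min 2 n\<^esup>. X \<subseteq> Y" if X: "hyperclique ?H X" for X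
    proof -
      have XV: "X \<subseteq> ?V" and "[X]\<^bsup>3\<^esup> = {}" using X by (simp_all add: hyperclique_def)
      moreover have fin: "finite X" using XV finite_subset by blast
      ultimately have "card X < 3" by (simp add: nsets_eq_empty_iff)
      moreover have "card X \<le> n" using card_mono[OF _ XV] by simp
      ultimately have "card X \<le> min 2 n" by simp
      then obtain Y where "X \<subseteq> Y" "Y \<subseteq> ?V" "card Y = min 2 n"
        using XV obtain_subset_with_card_n exists_subset_between[of X "min 2 n" ?V] by auto
      then show ?thesis using finite_subset[of Y ?V] by (auto simp: nsets_def)
    qed
  qed
  moreover have "num_maximal_cliques (complement ?H) \<le> card {?V}"
    by (rule num_maximal_cliques_le_card_cover) (auto simp: hyperclique_def complement_def)
  moreover have "triple_system ?H" using assms by (auto simp: triple_system_def lessThan_empty_iff)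
  ultimately show ?thesis using f3_2_le[of ?H n] by simp
qed

theorem theorem12:
  fixes n :: nat
  assumes "n \<ge> 1"
  shows "f3_2 n \<le> n ^ 2 div 4 + 5"
proof (cases "n \<le> 4")
  case True
  then have "n = 1 \<or> n = 2 \<or> n = 3 \<or> n = 4" using assms by auto
  then have "(n choose min 2 n) + 1 \<le> n ^ 2 div 4 + 5" by (auto simp: choose_two)
  then show ?thesis using f3_2_le_empty_system[OF assms] by linarith
next
  case False
  \<comment> \<open>The vertices other than the hubs are divided evenly, with the odd one in \<open>B\<close>: the
      families indexed by \<open>A\<close> outnumber those indexed by \<open>B\<close>.\<close>
  define a b where "a = (n - 4) div 2" and "b = (n - 3) div 2"
  have "n = a + b + 4" "b \<ge> 1" "b = a \<or> b = a + 1" using False by (auto simp: a_def b_def)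
  have "(a choose 2) + (b choose 2) + 3 * a + 2 * b + 9 \<le> n ^ 2 div 4 + 5"
  proof -
    have two: "2 * (k choose 2) + k = k * k" for k :: nat
      by (induction k) (auto simp: numeral_2_eq_2)
    \<comment> \<open>This is an equality for even \<open>n\<close>, and one short of it for odd \<open>n\<close>.\<close>
    have "4 * ((a choose 2) + (b choose 2) + 3 * a + 2 * b + 4) \<le> n ^ 2"
      using \<open>b = a \<or> b = a + 1\<close> two[of a] two[of b] unfolding \<open>n = _\<close>
      by (auto simp: power2_eq_square algebra_simps)
    from div_le_mono[OF this, of 4] show ?thesis by simp
  qed
  then show ?thesis using f3_2_le_hub_system[of b a] \<open>n = _\<close> \<open>b \<ge> 1\<close> by simp
qed

end
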